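(* Let $d\ge 2$. Every $d$-variate quasi-copula can be obtained as a pointwise supremum of a set of pointwise infima of sets of $d$-variate copulas, and it can also be obtained as a pointwise infimum of a set of pointwise suprema of sets of $d$-variate copulas. That is, for every $d$-variate quasi-copula $Q$ there exist indexed families $\{\mathcal{C}_i\}_{i\in I}$ and $\{\widetilde{\mathcal{C}}_j\}_{j\in J}$ of sets of $d$-variate copulas such that for all $\mathbf{u}\in[0,1]^d$ \[ Q(\mathbf{u})=\inf_{i\in I}\,\sup_{C\in\mathcal{C}_i}C(\mathbf{u})\quad\text{and}\quad Q(\mathbf{u})=\sup_{j\in J}\,\inf_{C\in\widetilde{\mathcal{C}}_j}C(\mathbf{u}). \]
   Context: A $d$-variate quasi-copula is a function $A\colon[0,1]^d\to[0,1]$ such that (i) $A(1,\ldots,1,u_j,1,\ldots,1)=u_j$ for every $j\in\{1,\dots,d\}$ and $u_j\in[0,1]$; (ii) $A$ is increasing (non-decreasing) in each variable; (iii) $|A(\mathbf{v})-A(\mathbf{u})|\le\sum_{j=1}^d|v_j-u_j|$ for all $\mathbf{u},\mathbf{v}\in[0,1]^d$. A $d$-variate copula is a function $A\colon[0,1]^d\to[0,1]$ satisfying (i), $A(\mathbf{u})=0$ whenever some $u_j=0$, and $V_A(R)\ge 0$ for every box $R=[x_1,y_1]\times\cdots\times[x_d,y_d]\subseteq[0,1]^d$, where $V_A(R)=\sum_{\mathbf{v}}\operatorname{sign}_R(\mathbf{v})A(\mathbf{v})$, the sum being over $\mathbf{v}\in\{x_1,y_1\}\times\cdots\times\{x_d,y_d\}$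 and $\operatorname{sign}_R(\mathbf v)=1$ if $v_j=x_j$ for an even number of indices $j$ and $-1$ otherwise. All index sets and all sets over which infima and suprema are taken are nonempty. *)

theory Defs
  imports "HOL-Analysis.Analysis"
begin

text \<open>
  A function \<open>[0,1]\<^sup>d \<rightarrow> [0,1]\<close> is represented by a total function on \<open>real ^ 'n\<close>, with
  \<open>d = CARD('n)\<close>; all conditions below concern only its values on the unit cube.
\<close>

definition unit_cube :: "(real ^ 'n) set"
  where "unit_cube = {u. \<forall>j. 0 \<le> u $ j \<and> u $ j \<le> 1}"

definition uniform_margins :: "(real ^ 'n \<Rightarrow> real) \<Rightarrow> bool"
  where "uniform_margins A \<longleftrightarrow> (\<forall>j. \<forall>t\<in>{0..1}. A (\<chi> i. if i = j then t else 1) = t)"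

definition quasi_copula :: "(real ^ 'n \<Rightarrow> real) \<Rightarrow> bool"
  where "quasi_copula A \<longleftrightarrow>
    A \<in> unit_cube \<rightarrow> {0..1} \<and>
    uniform_margins A \<and>
    (\<forall>j. \<forall>u\<in>unit_cube. \<forall>v\<in>unit_cube.
       (\<forall>i. i \<noteq> j \<longrightarrow> u $ i = v $ i) \<longrightarrow> u $ j \<le> v $ j \<longrightarrow> A u \<le> A v) \<and>
    (\<forall>u\<in>unit_cube. \<forall>v\<in>unit_cube. \<bar>A v - A u\<bar> \<le> (\<Sum>j\<in>UNIV. \<bar>v $ j - u $ j\<bar>))"

text \<open>
  The volume of the box \<open>[x, y]\<close>, summing over the set of its vertices. This is meaningful only
  if \<open>x $ j < y $ j\<close> for all \<open>j\<close>: for a degenerate box distinct corners coincide as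
  points and the signed sum no longer is the (vanishing) volume.
\<close>

definition box_volume :: "(real ^ 'n \<Rightarrow> real) \<Rightarrow> real ^ 'n \<Rightarrow> real ^ 'n \<Rightarrow> real"
  where "box_volume A x y =
    (\<Sum>v\<in>{v. \<forall>j. v $ j \<in> {x $ j, y $ j}}. (- 1) ^ card {j. v $ j = x $ j} * A v)"

definition copula :: "(real ^ 'n \<Rightarrow> real) \<Rightarrow> bool"
  where "copula A \<longleftrightarrow>
    A \<in> unit_cube \<rightarrow> {0..1} \<and>
    uniform_margins A \<and>
    (\<forall>u\<in>unit_cube. (\<exists>j. u $ j = 0) \<longrightarrow> A u = 0) \<and>
    (\<forall>x\<in>unit_cube. \<forall>y\<in>unit_cube. (\<forall>j. x $ j < y $ j) \<longrightarrow> 0 \<le> box_volume A x y)"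

text \<open>
  An indexed family of sets of copulas is given by its range, a set of sets of copulas. Infima and
  suprema over the family depend only on the range, and this way no index type has to be fixed.
\<close>

definition copula_family :: "(real ^ 'n \<Rightarrow> real) set set \<Rightarrow> bool"
  where "copula_family \<F> \<longleftrightarrow> \<F> \<noteq> {} \<and> (\<forall>\<C>\<in>\<F>. \<C> \<noteq> {} \<and> (\<forall>C\<in>\<C>. copula C))"

end

theory Submission imports Defs
begin

text \<open>
  Everything reduces to two points: for a quasi-copula \<open>Q\<close> and all \<open>v\<close>, \<open>w\<close> in the cube there is
  a copula \<open>K v w\<close> with \<open>Q v \<le> K v w v\<close> and \<open>K v w w \<le> Q w\<close>
  (\<open>copula_separating_two_points\<close>). Given this, \<open>SUP v. K v w\<close> lies above \<open>Q\<close> everywhere and does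
  not exceed it at \<open>w\<close>, so the infimum over \<open>w\<close> is \<open>Q\<close>; dually \<open>INF w. K v w\<close> lies below \<open>Q\<close> and
  reaches it at \<open>v\<close>, so the supremum over \<open>v\<close> is \<open>Q\<close>.

  To find \<open>K v w\<close>, put \<open>a = Q v\<close>, \<open>b = Q w\<close> and think of a random vector \<open>U\<close> with uniform margins
  that satisfies \<open>U \<le> v\<close> on an event \<open>V\<close> of probability \<open>a\<close>. How the mass of the \<open>i\<close>-th margin is
  divided between \<open>V\<close> and its complement is decided by one number \<open>x i\<close>, the mass inside \<open>V\<close> on
  which \<open>U\<close> exceeds \<open>w\<close> in coordinate \<open>i\<close>. On each of the two events the conditional distribution
  with the prescribed margins can be chosen so that it attains the lower Frechet bound at \<open>w\<close>
  (\<open>frechet_lower_bound_attained\<close>): the sets where different coordinates exceed \<open>w\<close> overlap as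
  little as possible. The resulting probability of \<open>U \<le> w\<close> is at most
  \<open>max 0 (a - \<Sum>x) + max 0 (1 - a - \<Sum>(1 - w) + \<Sum>x)\<close>, and the three elementary properties
  \<open>1 - \<Sum>(1 - w) \<le> b\<close>, \<open>a \<le> v i\<close> and \<open>a - b \<le> \<Sum>max 0 (v - w)\<close> of a quasi-copula are what
  is needed to choose \<open>x\<close> so that this is at most \<open>b\<close>.

  All distributions are finite mixtures of product distributions. Their box volumes are
  nonnegative because the volume of a product is the product of the increments of its factors, so
  no measure theory is involved.
\<close>

section \<open>Mixtures of product distribution functions\<close>

definition unit_cdf :: "(real \<Rightarrow> real) \<Rightarrow> bool"
  where "unit_cdf g \<longleftrightarrow> mono_on {0..1} g \<and> g 0 = 0 \<and> g 1 = 1"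

lemma unit_cdf_mono:
  "unit_cdf g \<Longrightarrow> 0 \<le> s \<Longrightarrow> s \<le> t \<Longrightarrow> t \<le> 1 \<Longrightarrow> g s \<le> g t"
  unfolding unit_cdf_def by (auto elim!: mono_onD)

lemma unit_cdf_range:
  assumes "unit_cdf g" "0 \<le> t" "t \<le> 1"
  shows "0 \<le> g t" "g t \<le> 1"
  using unit_cdf_mono[of g 0 t] unit_cdf_mono[of g t 1] assms by (auto simp: unit_cdf_def)

lemma unit_cdf_compose:
  assumes "unit_cdf f" "unit_cdf g"
  shows "unit_cdf (\<lambda>t. f (g t))"
  using assms unit_cdf_range[OF assms(2)]
  by (auto simp: unit_cdf_def monotone_on_def)

definition mixture_df ::
    "('k::finite \<Rightarrow> real) \<Rightarrow> ('k \<Rightarrow> 'n \<Rightarrow> real \<Rightarrow> real) \<Rightarrow> real ^ 'n \<Rightarrow> real"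
  where "mixture_df \<omega> g u = (\<Sum>k\<in>UNIV. \<omega> k * (\<Prod>i\<in>UNIV. g k i (u $ i)))"

text \<open>
  The \<open>k\<close>-th component of the mixture has weight \<open>\<omega> k\<close> and independent coordinates with distribution
  functions \<open>g k i\<close>; then \<open>F i\<close> is the \<open>i\<close>-th margin of the mixture. Only the margins constrain the
  components jointly, so a copula arises as soon as the weighted components average to the uniform
  distribution in every coordinate.
\<close>

definition mixture_margins ::
    "('k::finite \<Rightarrow> real) \<Rightarrow> ('k \<Rightarrow> 'n \<Rightarrow> real \<Rightarrow> real) \<Rightarrow> ('n \<Rightarrow> real \<Rightarrow> real) \<Rightarrow> bool"
  where "mixture_margins \<omega> g F \<longleftrightarrow>
    (\<forall>k. 0 \<le> \<omega> k) \<and> sum \<omega> UNIV = 1 \<and> (\<forall>k i. unit_cdf (g k i)) \<and>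
    (\<forall>i. \<forall>t\<in>{0..1}. (\<Sum>k\<in>UNIV. \<omega> k * g k i t) = F i t)"

text \<open>
  The vertices of a nondegenerate box correspond to the sets of coordinates at which the lower
  endpoint is chosen, and with this indexing the signed sum is the expansion of the product of
  differences.
\<close>

lemma box_volume_product:
  fixes g :: "'n::finite \<Rightarrow> real \<Rightarrow> real"
  assumes "\<forall>j. x $ j < y $ j"
  shows "box_volume (\<lambda>u. \<Prod>i\<in>UNIV. g i (u $ i)) x y = (\<Prod>i\<in>UNIV. g i (y $ i) - g i (x $ i))"
proof -
  define vertex :: "'n set \<Rightarrow> real ^ 'n"
    where "vertex S = (\<chi> j. if j \<in> S then x $ j else y $ j)" for S
  have lower: "{j. vertex S $ j = x $ j} = S" for S
    using assms by (auto simp: vertex_def) (metis less_irrefl)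
  have bij: "bij_betw vertex (Pow UNIV) {v. \<forall>j. v $ j \<in> {x $ j, y $ j}}"
  proof (rule bij_betw_byWitness[where f' = "\<lambda>v. {j. v $ j = x $ j}"])
    show "\<forall>v\<in>{v. \<forall>j. v $ j \<in> {x $ j, y $ j}}. vertex {j. v $ j = x $ j} = v"
      by (auto simp: vertex_def vec_eq_iff)
  qed (auto simp: lower, auto simp: vertex_def)
  have prod_vertex: "(\<Prod>i\<in>UNIV. g i (vertex S $ i))
      = (\<Prod>i\<in>S. g i (x $ i)) * (\<Prod>i\<in>UNIV - S. g i (y $ i))" for S
  proof -
    have "(\<Prod>i\<in>UNIV. g i (vertex S $ i))
        = (\<Prod>i\<in>S. g i (vertex S $ i)) * (\<Prod>i\<in>UNIV - S. g i (vertex S $ i))"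
      by (subst prod.subset_diff[of S UNIV]) (auto simp: mult.commute)
    then show ?thesis by (simp add: vertex_def)
  qed
  show ?thesis
    unfolding box_volume_def
    by (subst sum.reindex_bij_betw[OF bij, symmetric])
      (simp add: lower prod_vertex prod_diff_conv_sum mult.assoc)
qed

lemma copula_mixture_df:
  fixes g :: "'k::finite \<Rightarrow> 'n::finite \<Rightarrow> real \<Rightarrow> real"
  assumes "mixture_margins \<omega> g (\<lambda>i t. t)"
  shows "copula (mixture_df \<omega> g)"
proof -
  have w: "0 \<le> \<omega> k" and w1: "sum \<omega> UNIV = 1" and cdf: "unit_cdf (g k i)" for k i
    using assms by (auto simp: mixture_margins_def)
  have margin: "(\<Sum>k\<in>UNIV. \<omega> k * g k i t) = t" if "0 \<le> t" "t \<le> 1" for i t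
    using assms that by (auto simp: mixture_margins_def)
  have range: "mixture_df \<omega> g u \<in> {0..1}" if u: "u \<in> unit_cube" for u
  proof -
    have p: "0 \<le> (\<Prod>i\<in>UNIV. g k i (u $ i))" "(\<Prod>i\<in>UNIV. g k i (u $ i)) \<le> 1" for k
      using u unit_cdf_range[OF cdf] by (auto simp: unit_cube_def intro!: prod_nonneg prod_le_1)
    have "mixture_df \<omega> g u \<le> (\<Sum>k\<in>UNIV. \<omega> k * 1)"
      unfolding mixture_df_def by (intro sum_mono mult_left_mono p w)
    moreover have "0 \<le> mixture_df \<omega> g u"
      unfolding mixture_df_def by (intro sum_nonneg mult_nonneg_nonneg p w)
    ultimately show ?thesis using w1 by simp
  qed
  have margins: "mixture_df \<omega> g (\<chi> i. if i = j then t else 1) = t"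
    if t: "t \<in> {0..1}" for j t
  proof -
    have "(\<Prod>i\<in>UNIV. g k i (if i = j then t else 1)) = g k j t" for k
    proof -
      have "(\<Prod>i\<in>UNIV. g k i (if i = j then t else 1)) = (\<Prod>i\<in>UNIV. if i = j then g k j t else 1)"
        using cdf by (intro prod.cong) (auto simp: unit_cdf_def)
      then show ?thesis by simp
    qed
    then show ?thesis using margin t by (simp add: mixture_df_def)
  qed
  have grounded: "mixture_df \<omega> g u = 0" if "u $ j = 0" for u :: "real ^ 'n" and j
  proof -
    have "(\<Prod>i\<in>UNIV. g k i (u $ i)) = 0" for k
      using that cdf[of k j] by (intro prod_zero) (auto simp: unit_cdf_def intro!: exI[of _ j])
    then show ?thesis unfolding mixture_df_def by (simp only: mult_zero_right sum.neutral_const)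
  qed
  have volume: "0 \<le> box_volume (mixture_df \<omega> g) x y"
    if "x \<in> unit_cube" "y \<in> unit_cube" and less: "\<forall>j. x $ j < y $ j" for x y
  proof -
    have "box_volume (mixture_df \<omega> g) x y
        = (\<Sum>k\<in>UNIV. \<omega> k * box_volume (\<lambda>u. \<Prod>i\<in>UNIV. g k i (u $ i)) x y)"
      unfolding box_volume_def mixture_df_def sum_distrib_left
      by (subst sum.swap) (simp add: mult.left_commute)
    also have "\<dots> = (\<Sum>k\<in>UNIV. \<omega> k * (\<Prod>i\<in>UNIV. g k i (y $ i) - g k i (x $ i)))"
      by (simp add: box_volume_product[OF less])
    also have "\<dots> \<ge> 0"
    proof (intro sum_nonneg mult_nonneg_nonneg prod_nonneg w)
      fix k i
      have "0 \<le> x $ i" "x $ i \<le> y $ i" "y $ i \<le> 1"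
        using that by (simp_all add: unit_cube_def less_imp_le)
      then show "0 \<le> g k i (y $ i) - g k i (x $ i)"
        using unit_cdf_mono[OF cdf] by simp
    qed
    finally show ?thesis .
  qed
  show ?thesis
    unfolding copula_def uniform_margins_def
    using range margins grounded volume by blast
qed

text \<open>
  Weierstrass' product inequality, which is the lower Frechet bound for independent coordinates.
\<close>

lemma prod_ge_one_minus_sum:
  fixes f :: "'i \<Rightarrow> real"
  assumes "finite A" "\<And>i. i \<in> A \<Longrightarrow> 0 \<le> f i" "\<And>i. i \<in> A \<Longrightarrow> f i \<le> 1"
  shows "1 - (\<Sum>i\<in>A. 1 - f i) \<le> prod f A"
  using assms
proof (induction A rule: finite_induct)
  case (insert i A)
  have "0 \<le> (1 - f i) * (1 - prod f A)"
    using insert.prems by (intro mult_nonneg_nonneg) (auto intro!: prod_le_1)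
  moreover have "1 - (\<Sum>i\<in>A. 1 - f i) \<le> prod f A"
    using insert by auto
  ultimately show ?case using insert.hyps by (simp add: algebra_simps)
qed simp

text \<open>
  The lower Frechet bound is affine in the margins, hence it passes from products to mixtures. It
  is applied at points where all margins have reached 1, to see that the full mass lies below them.
\<close>

lemma mixture_df_lower_bound:
  fixes g :: "'k::finite \<Rightarrow> 'n::finite \<Rightarrow> real \<Rightarrow> real"
  assumes m: "mixture_margins \<omega> g F" and u: "u \<in> unit_cube"
  shows "1 - (\<Sum>i\<in>UNIV. 1 - F i (u $ i)) \<le> mixture_df \<omega> g u" "0 \<le> mixture_df \<omega> g u"
proof -
  have w: "0 \<le> \<omega> k" and w1: "sum \<omega> UNIV = 1" and cdf: "unit_cdf (g k i)" for k i
    using m by (auto simp: mixture_margins_def)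
  have g: "0 \<le> g k i (u $ i)" "g k i (u $ i) \<le> 1" for k i
    using unit_cdf_range[OF cdf] u by (auto simp: unit_cube_def)
  have margin: "F i (u $ i) = (\<Sum>k\<in>UNIV. \<omega> k * g k i (u $ i))" for i
    using m u by (auto simp: mixture_margins_def unit_cube_def)
  have "(\<Sum>i\<in>UNIV. 1 - F i (u $ i)) = (\<Sum>i\<in>UNIV. \<Sum>k\<in>UNIV. \<omega> k * (1 - g k i (u $ i)))"
    by (simp add: margin algebra_simps sum_subtractf w1)
  also have "\<dots> = (\<Sum>k\<in>UNIV. \<omega> k * (\<Sum>i\<in>UNIV. 1 - g k i (u $ i)))"
    by (subst sum.swap) (simp add: sum_distrib_left)
  finally have "1 - (\<Sum>i\<in>UNIV. 1 - F i (u $ i))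
      = (\<Sum>k\<in>UNIV. \<omega> k * (1 - (\<Sum>i\<in>UNIV. 1 - g k i (u $ i))))"
    by (simp add: right_diff_distrib sum_subtractf w1)
  also have "\<dots> \<le> mixture_df \<omega> g u"
    unfolding mixture_df_def by (intro sum_mono mult_left_mono prod_ge_one_minus_sum w g) auto
  finally show "1 - (\<Sum>i\<in>UNIV. 1 - F i (u $ i)) \<le> mixture_df \<omega> g u" .
  show "0 \<le> mixture_df \<omega> g u"
    unfolding mixture_df_def by (intro sum_nonneg mult_nonneg_nonneg prod_nonneg w g)
qed

lemma sum_UNIV_bool_prod:
  fixes f :: "bool \<times> 'k::finite \<Rightarrow> real"
  shows "sum f UNIV = (\<Sum>k\<in>UNIV. f (True, k)) + (\<Sum>k\<in>UNIV. f (False, k))"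
proof -
  have "sum f UNIV = (\<Sum>b\<in>UNIV. \<Sum>k\<in>UNIV. f (b, k))"
    by (simp add: sum.cartesian_product)
  then show ?thesis by (simp add: UNIV_bool)
qed

lemma mixture_convex_combination:
  fixes g1 g2 :: "'k::finite \<Rightarrow> 'n::finite \<Rightarrow> real \<Rightarrow> real"
  assumes "mixture_margins \<omega>1 g1 F1" "mixture_margins \<omega>2 g2 F2" "0 \<le> a" "a \<le> 1"
  obtains \<omega> :: "bool \<times> 'k \<Rightarrow> real" and g :: "bool \<times> 'k \<Rightarrow> 'n \<Rightarrow> real \<Rightarrow> real"
  where "mixture_margins \<omega> g (\<lambda>i t. a * F1 i t + (1 - a) * F2 i t)"
    and "\<And>u. mixture_df \<omega> g u = a * mixture_df \<omega>1 g1 u + (1 - a) * mixture_df \<omega>2 g2 u"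
proof
  let ?\<omega> = "\<lambda>(b, k). if b then a * \<omega>1 k else (1 - a) * \<omega>2 k"
  let ?g = "\<lambda>(b, k). if b then g1 k else g2 k"
  show "mixture_margins ?\<omega> ?g (\<lambda>i t. a * F1 i t + (1 - a) * F2 i t)"
    using assms unfolding mixture_margins_def sum_UNIV_bool_prod
    by (auto simp: mult.assoc simp flip: sum_distrib_left)
  show "mixture_df ?\<omega> ?g u = a * mixture_df \<omega>1 g1 u + (1 - a) * mixture_df \<omega>2 g2 u" for u
    unfolding mixture_df_def sum_UNIV_bool_prod
    by (simp add: mult.assoc flip: sum_distrib_left)
qed

section \<open>Attaining the lower Frechet bound at a point\<close>

text \<open>
  The uniform distribution is a mixture of a part \<open>A\<close> living above \<open>1 - r\<close> and a part \<open>B\<close> living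
  below. Putting the weight \<open>r\<close> into the last claim makes it true also for \<open>r = 0\<close>, where \<open>A\<close> is
  an arbitrary distribution function.
\<close>

lemma split_uniform:
  fixes r :: real
  assumes "0 \<le> r" "r \<le> 1"
  obtains A B where "unit_cdf A" "unit_cdf B"
    "\<And>t. 0 \<le> t \<Longrightarrow> t \<le> 1 \<Longrightarrow> r * A t + (1 - r) * B t = t"
    "\<And>t. 0 \<le> t \<Longrightarrow> t \<le> 1 - r \<Longrightarrow> r * A t = 0"
proof
  define A where "A = (\<lambda>t. if r = 0 then t else max 0 (t - (1 - r)) / r)"
  define B where "B = (\<lambda>t. if r = 1 then t else min t (1 - r) / (1 - r))"
  show "unit_cdf A" "unit_cdf B"
    using assms
    by (auto simp: A_def B_def unit_cdf_def monotone_on_def intro!: divide_right_mono)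
  show "r * A t + (1 - r) * B t = t" if "0 \<le> t" "t \<le> 1" for t
    using that by (auto simp: A_def B_def)
  show "r * A t = 0" if "0 \<le> t" "t \<le> 1 - r" for t
    using that by (auto simp: A_def)
qed

lemma sum_UNIV_option:
  fixes f :: "'n::finite option \<Rightarrow> real"
  shows "sum f UNIV = f None + (\<Sum>k\<in>UNIV. f (Some k))"
  by (simp add: UNIV_option_conv sum.reindex)

text \<open>
  At \<open>w\<close> the bound is attained when the events that coordinate \<open>i\<close> exceeds \<open>w $ i\<close>, of
  probabilities \<open>q i = 1 - F i (w $ i)\<close>, are disjoint or else cover everything. Component \<open>Some k\<close>
  of the mixture is a part of the event for \<open>k\<close> and so contributes nothing to the value at \<open>w\<close>;
  component \<open>None\<close> carries the remaining weight. If the \<open>q i\<close> add up to more than 1, they cannot be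
  the weights; they are scaled down to \<open>r i\<close>, which amounts to raising the values \<open>F i (w $ i)\<close>
  to \<open>1 - r i\<close>, so that the mixture vanishes even at a point above \<open>w\<close>.
\<close>

lemma frechet_lower_bound_attained:
  fixes F :: "'n::finite \<Rightarrow> real \<Rightarrow> real"
  assumes F: "\<And>i. unit_cdf (F i)" and w: "w \<in> unit_cube"
  obtains \<omega> :: "'n option \<Rightarrow> real" and g
  where "mixture_margins \<omega> g F"
    and "mixture_df \<omega> g w \<le> max 0 (1 - (\<Sum>i\<in>UNIV. 1 - F i (w $ i)))"
proof -
  define q where "q i = 1 - F i (w $ i)" for i
  define s where "s = max 1 (sum q UNIV)"
  define r where "r i = q i / s" for i
  have q: "0 \<le> q i" "q i \<le> 1" for i
    using unit_cdf_range[OF F] w by (auto simp: q_def unit_cube_def)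
  have s: "1 \<le> s" by (simp add: s_def)
  have r: "0 \<le> r i" "r i \<le> q i" for i
    using q[of i] s by (auto simp: r_def divide_simps mult_le_cancel_left1)
  have r1: "r i \<le> 1" for i using r[of i] q[of i] by linarith
  have sum_r: "sum r UNIV = sum q UNIV / s"
    unfolding r_def by (simp add: sum_divide_distrib)
  have "sum r UNIV \<le> 1" using s unfolding sum_r by (simp add: divide_simps s_def)
  have remainder: "1 - sum r UNIV = max 0 (1 - sum q UNIV)"
    unfolding sum_r s_def by (auto simp: max_def)
  have "\<forall>i. \<exists>A B. unit_cdf A \<and> unit_cdf B \<and>
      (\<forall>t. 0 \<le> t \<longrightarrow> t \<le> 1 \<longrightarrow> r i * A t + (1 - r i) * B t = t) \<and>
      (\<forall>t. 0 \<le> t \<longrightarrow> t \<le> 1 - r i \<longrightarrow> r i * A t = 0)"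
    using split_uniform[OF r(1) r1] by metis
  then obtain A B where
    AB: "\<And>i. unit_cdf (A i)" "\<And>i. unit_cdf (B i)"
      "\<And>i t. 0 \<le> t \<Longrightarrow> t \<le> 1 \<Longrightarrow> r i * A i t + (1 - r i) * B i t = t"
      "\<And>i t. 0 \<le> t \<Longrightarrow> t \<le> 1 - r i \<Longrightarrow> r i * A i t = 0"
    by metis
  define \<omega> where "\<omega> = case_option (1 - sum r UNIV) r"
  define g where "g k i = (\<lambda>t. if k = Some i then A i (F i t) else B i (F i t))" for k i
  have cdf: "unit_cdf (g k i)" for k i
    using unit_cdf_compose[OF AB(1) F] unit_cdf_compose[OF AB(2) F] by (cases "k = Some i") (simp_all add: g_def)
  have w0: "0 \<le> \<omega> k" for k
    using r \<open>sum r UNIV \<le> 1\<close> by (simp add: \<omega>_def split: option.split)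
  have margin: "(\<Sum>k\<in>UNIV. \<omega> k * g k i t) = F i t" if "t \<in> {0..1}" for i t
  proof -
    have "(\<Sum>k\<in>UNIV. r k * g (Some k) i t)
        = r i * A i (F i t) + (\<Sum>k\<in>UNIV - {i}. r k * g (Some k) i t)"
      by (subst sum.remove[of _ i]) (auto simp: g_def)
    also have "(\<Sum>k\<in>UNIV - {i}. r k * g (Some k) i t) = (\<Sum>k\<in>UNIV - {i}. r k) * B i (F i t)"
      unfolding sum_distrib_right by (intro sum.cong) (auto simp: g_def)
    also have "(\<Sum>k\<in>UNIV - {i}. r k) = sum r UNIV - r i"
      by (simp add: sum_diff1)
    finally have "(\<Sum>k\<in>UNIV. \<omega> k * g k i t) = r i * A i (F i t) + (1 - r i) * B i (F i t)"
      by (simp add: sum_UNIV_option \<omega>_def g_def algebra_simps)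
    then show ?thesis using AB(3) unit_cdf_range[OF F] that by auto
  qed
  have "mixture_margins \<omega> g F"
    unfolding mixture_margins_def using w0 cdf margin
    by (auto simp: sum_UNIV_option \<omega>_def)
  moreover have "mixture_df \<omega> g w \<le> 1 - sum r UNIV"
  proof -
    have killed: "r k * (\<Prod>i\<in>UNIV. g (Some k) i (w $ i)) = 0" for k
    proof -
      have "r k * A k (F k (w $ k)) = 0"
        using r(2)[of k] unit_cdf_range[OF F] w
        by (intro AB(4)) (auto simp: q_def unit_cube_def)
      then show ?thesis
        by (subst prod.remove[of _ k]) (auto simp: g_def)
    qed
    have "(\<Prod>i\<in>UNIV. g None i (w $ i)) \<le> 1"
      using w unit_cdf_range[OF cdf] by (intro prod_le_1) (auto simp: unit_cube_def)
    then have "(1 - sum r UNIV) * (\<Prod>i\<in>UNIV. g None i (w $ i)) \<le> 1 - sum r UNIV"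
      using \<open>sum r UNIV \<le> 1\<close> by (intro mult_left_le) auto
    then show ?thesis
      by (simp add: mixture_df_def sum_UNIV_option \<omega>_def killed)
  qed
  ultimately show ?thesis
    using that remainder by (simp add: q_def)
qed

section \<open>Elementary bounds for quasi-copulas\<close>

text \<open>
  Monotonicity in each variable is applied to the coordinates one after the other.
\<close>

lemma quasi_copula_mono:
  fixes u v :: "real ^ 'n::finite"
  assumes Q: "quasi_copula Q" and u: "u \<in> unit_cube" and v: "v \<in> unit_cube"
    and le: "\<And>i. u $ i \<le> v $ i"
  shows "Q u \<le> Q v"
proof -
  define step :: "'n set \<Rightarrow> real ^ 'n" where "step S = (\<chi> i. if i \<in> S then v $ i else u $ i)" for S
  have cube: "step S \<in> unit_cube" for S
    using u v by (auto simp: step_def unit_cube_def)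
  have "Q u \<le> Q (step S)" for S
  proof (induction S rule: infinite_finite_induct)
    case empty
    have "step {} = u" by (simp add: step_def vec_eq_iff)
    then show ?case by simp
  next
    case (insert j S)
    have one: "\<forall>j. \<forall>u\<in>unit_cube. \<forall>v\<in>unit_cube.
       (\<forall>i. i \<noteq> j \<longrightarrow> u $ i = v $ i) \<longrightarrow> u $ j \<le> v $ j \<longrightarrow> Q u \<le> Q v"
      using Q by (simp add: quasi_copula_def)
    have "Q (step S) \<le> Q (step (insert j S))"
      using one[rule_format, OF cube cube, of j S "insert j S"] le by (simp add: step_def)
    then show ?case using insert by simp
  qed simp
  from this[of UNIV] show ?thesis by (simp add: step_def)
qed

lemma quasi_copula_le_coordinate:
  fixes u :: "real ^ 'n::finite"
  assumes Q: "quasi_copula Q" and u: "u \<in> unit_cube"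
  shows "Q u \<le> u $ j"
proof -
  have "Q u \<le> Q (\<chi> i. if i = j then u $ j else 1)"
    using u by (intro quasi_copula_mono[OF Q]) (auto simp: unit_cube_def)
  then show ?thesis
    using Q u by (auto simp: quasi_copula_def uniform_margins_def unit_cube_def)
qed

text \<open>
  Decreasing coordinates cost nothing: by monotonicity \<open>u\<close> may be replaced by the coordinatewise
  minimum of \<open>u\<close> and \<open>v\<close> before the Lipschitz condition is applied.
\<close>

lemma quasi_copula_increment:
  fixes u v :: "real ^ 'n::finite"
  assumes Q: "quasi_copula Q" and u: "u \<in> unit_cube" and v: "v \<in> unit_cube"
  shows "Q v - Q u \<le> (\<Sum>i\<in>UNIV. max 0 (v $ i - u $ i))"
proof -
  define m :: "real ^ 'n" where "m = (\<chi> i. min (v $ i) (u $ i))"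
  have m: "m \<in> unit_cube" using u v by (auto simp: m_def unit_cube_def min_le_iff_disj)
  have "\<bar>Q v - Q m\<bar> \<le> (\<Sum>i\<in>UNIV. \<bar>v $ i - m $ i\<bar>)"
    using Q m v by (simp add: quasi_copula_def)
  also have "\<dots> = (\<Sum>i\<in>UNIV. max 0 (v $ i - u $ i))"
    by (intro sum.cong) (auto simp: m_def)
  finally show ?thesis
    using quasi_copula_mono[OF Q m u] by (auto simp: m_def)
qed

lemma quasi_copula_range:
  assumes "quasi_copula Q" "u \<in> unit_cube"
  shows "0 \<le> Q u" "Q u \<le> 1"
  using assms by (auto simp: quasi_copula_def)

lemma quasi_copula_ge_frechet:
  fixes u :: "real ^ 'n::finite"
  assumes Q: "quasi_copula Q" and u: "u \<in> unit_cube"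
  shows "1 - (\<Sum>i\<in>UNIV. 1 - u $ i) \<le> Q u"
proof -
  have one: "(1 :: real ^ 'n) \<in> unit_cube" by (simp add: unit_cube_def)
  have "uniform_margins Q" using Q by (simp add: quasi_copula_def)
  then have "\<forall>j. Q (\<chi> i. if i = j then 1 else 1) = 1"
    unfolding uniform_margins_def by (intro allI) (erule allE, erule bspec, simp)
  then have "Q 1 = 1" by (simp add: one_vec_def)
  moreover have "(\<Sum>i\<in>UNIV. max 0 ((1 :: real ^ 'n) $ i - u $ i)) = (\<Sum>i\<in>UNIV. 1 - u $ i)"
    using u by (intro sum.cong) (auto simp: unit_cube_def)
  ultimately show "1 - (\<Sum>i\<in>UNIV. 1 - u $ i) \<le> Q u"
    using quasi_copula_increment[OF Q u one] by simp
qed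

section \<open>Copulas separating a quasi-copula at two points\<close>

text \<open>
  The box with opposite corners \<open>l\<close> and \<open>h\<close> is connected, so the sum of coordinates takes every
  intermediate value, already on its diagonal.
\<close>

lemma sum_between:
  fixes l h :: "'i \<Rightarrow> real"
  assumes "finite I" "\<And>i. i \<in> I \<Longrightarrow> l i \<le> h i" "sum l I \<le> S" "S \<le> sum h I"
  obtains x where "\<And>i. i \<in> I \<Longrightarrow> l i \<le> x i \<and> x i \<le> h i" "sum x I = S"
proof (cases "sum l I = sum h I")
  case True
  then show ?thesis using assms that[of l] by auto
next
  case False
  define \<theta> where "\<theta> = (S - sum l I) / (sum h I - sum l I)"
  have pos: "sum l I < sum h I" using False assms by linarith
  have \<theta>: "0 \<le> \<theta>" "\<theta> \<le> 1" using assms pos by (auto simp: \<theta>_def divide_simps)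
  show ?thesis
  proof (rule that[of "\<lambda>i. l i + \<theta> * (h i - l i)"])
    show "l i \<le> l i + \<theta> * (h i - l i) \<and> l i + \<theta> * (h i - l i) \<le> h i" if "i \<in> I" for i
      using \<theta> assms(2)[OF that] mult_left_le_one_le[of "h i - l i" \<theta>] by auto
    show "(\<Sum>i\<in>I. l i + \<theta> * (h i - l i)) = S"
    proof -
      have "(\<Sum>i\<in>I. \<theta> * (h i - l i)) = \<theta> * (sum h I - sum l I)"
        by (simp add: sum_subtractf flip: sum_distrib_left)
      also have "\<dots> = S - sum l I" using pos by (simp add: \<theta>_def)
      finally show ?thesis by (simp add: sum.distrib)
    qed
  qed
qed

text \<open>
  Either one summand alone reaches the cap \<open>c\<close>, or no summand is cut off.
\<close>

lemma sum_min_const_ge: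
  fixes f :: "'i \<Rightarrow> real"
  assumes "finite I" "\<And>i. i \<in> I \<Longrightarrow> 0 \<le> f i" "0 \<le> c"
  shows "min c (sum f I) \<le> (\<Sum>i\<in>I. min c (f i))"
proof (cases "\<exists>i\<in>I. c \<le> f i")
  case True
  then obtain i where i: "i \<in> I" "c \<le> f i" by blast
  have "min c (f i) \<le> (\<Sum>i\<in>I. min c (f i))"
    using assms i by (intro member_le_sum) auto
  then show ?thesis using i by auto
next
  case False
  then have "(\<Sum>i\<in>I. min c (f i)) = sum f I" by (intro sum.cong) auto
  then show ?thesis by simp
qed

text \<open>
  Here \<open>\<Phi> t\<close> is the mass that one coordinate has in \<open>{0..t}\<close> on the event \<open>V\<close> of probability \<open>a\<close>, and
  \<open>t - \<Phi> t\<close> is its mass there on the complement; monotonicity of both makes them margins up to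
  normalisation. On \<open>V\<close> the coordinate does not exceed \<open>v\<close>, and it exceeds \<open>w\<close> with mass \<open>x\<close>. The
  bounds on \<open>x\<close> say that the mass \<open>a - x\<close> fits into \<open>{0..w}\<close> and the mass \<open>x\<close> into \<open>{w..v}\<close>; each of
  the two summands of the witness fills its interval from the left.
\<close>

lemma margin_part:
  fixes a v w x :: real
  assumes "0 \<le> w" "w \<le> 1" "v \<le> 1" "a \<le> v"
    and "0 \<le> x" "a - w \<le> x" "x \<le> a" "x \<le> max 0 (v - w)"
  obtains \<Phi> where "\<Phi> 0 = 0" "\<Phi> 1 = a" "\<Phi> v = a" "\<Phi> w = a - x"
    "mono \<Phi>" "mono (\<lambda>t. t - \<Phi> t)"
proof
  let ?\<Phi> = "\<lambda>t. min (min t w) (a - x) + min (max (t - w) 0) x"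
  show "?\<Phi> 0 = 0" "?\<Phi> w = a - x" using assms by simp_all
  show "?\<Phi> 1 = a" "?\<Phi> v = a" using assms by linarith+
  show "mono ?\<Phi>" by (intro monoI) linarith
  show "mono (\<lambda>t. t - ?\<Phi> t)" using assms by (intro monoI) linarith
qed

text \<open>
  The mixture gives \<open>H\<^sub>1\<close>, with margins \<open>\<Phi> i t / a\<close>, the weight \<open>a\<close> and \<open>H\<^sub>2\<close>, with margins
  \<open>(t - \<Phi> i t) / (1 - a)\<close>, the weight \<open>1 - a\<close>. Since \<open>H\<^sub>1\<close> has all its mass below \<open>v\<close>, the value
  at \<open>v\<close> is at least \<open>a\<close>. The value at \<open>w\<close> is kept below \<open>b\<close> by making \<open>\<Sum>x\<close> at least \<open>a - b\<close>, so
  that little of \<open>H\<^sub>1\<close> is below \<open>w\<close>, but no larger than necessary, so that \<open>H\<^sub>2\<close> retains enough mass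
  above \<open>w\<close>.
\<close>

lemma copula_separating_two_points:
  fixes Q :: "real ^ 'n::finite \<Rightarrow> real"
  assumes Q: "quasi_copula Q" and v: "v \<in> unit_cube" and w: "w \<in> unit_cube"
  obtains C where "copula C" "Q v \<le> C v" "C w \<le> Q w"
proof -
  define a b where "a = Q v" and "b = Q w"
  have b: "0 \<le> b" "1 - (\<Sum>i\<in>UNIV. 1 - w $ i) \<le> b"
    using quasi_copula_ge_frechet[OF Q w] quasi_copula_range[OF Q w] by (auto simp: b_def)
  have a: "0 \<le> a" "a \<le> 1" using quasi_copula_range[OF Q v] by (auto simp: a_def)
  have av: "a \<le> v $ i" for i
    using quasi_copula_le_coordinate[OF Q v] by (simp add: a_def)
  have v01: "0 \<le> v $ i" "v $ i \<le> 1" and w01: "0 \<le> w $ i" "w $ i \<le> 1" for i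
    using v w by (auto simp: unit_cube_def)
  have ab: "a - b \<le> (\<Sum>i\<in>UNIV. max 0 (v $ i - w $ i))"
    using quasi_copula_increment[OF Q w v] by (simp add: a_def b_def)
  show ?thesis
  proof (cases "a = 0 \<or> a = 1")
    case True
    \<comment> \<open>One of the two conditional distributions would be undefined. A single distribution
      attaining the lower Frechet bound at \<open>w\<close> suffices: for \<open>a = 1\<close> all \<open>v $ i\<close> are 1.\<close>
    have "unit_cdf (\<lambda>t. t)" by (simp add: unit_cdf_def monotone_on_def)
    then obtain \<omega> :: "'n option \<Rightarrow> real" and g where m: "mixture_margins \<omega> g (\<lambda>i t. t)"
      and le: "mixture_df \<omega> g w \<le> max 0 (1 - (\<Sum>i\<in>UNIV. 1 - w $ i))"
      using frechet_lower_bound_attained[of "\<lambda>_ t. t" w] w by blast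
    have "a \<le> mixture_df \<omega> g v"
      using True
    proof
      assume "a = 1"
      then have "v $ i = 1" for i using av[of i] v01[of i] by simp
      then show ?thesis using mixture_df_lower_bound(1)[OF m v] \<open>a = 1\<close> by simp
    qed (use mixture_df_lower_bound(2)[OF m v] in simp)
    moreover have "mixture_df \<omega> g w \<le> b" using le b by simp
    ultimately show ?thesis
      using that copula_mixture_df[OF m] by (simp add: a_def b_def)
  next
    case False
    then have a01: "0 < a" "a < 1" using a by auto
    \<comment> \<open>The interval in which \<open>margin_part\<close> permits \<open>x i\<close> to be chosen; the upper bound
      forces \<open>x i = 0\<close> where \<open>v $ i \<le> w $ i\<close>.\<close>
    define l h where "l i = max 0 (a - w $ i)" and "h i = min a (max 0 (v $ i - w $ i))" for i
    have lh: "l i \<le> h i" for i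
      using av[of i] w01[of i] a by (auto simp: l_def h_def)
    have sum_h: "a - b \<le> sum h UNIV"
      using sum_min_const_ge[of UNIV "\<lambda>i. max 0 (v $ i - w $ i)" a] ab a b
      by (auto simp: h_def)
    have sum_l: "sum l UNIV \<le> b - (1 - a) + (\<Sum>i\<in>UNIV. 1 - w $ i)"
    proof -
      have "sum l UNIV = (\<Sum>i\<in>UNIV. (1 - w $ i) - min (1 - a) (1 - w $ i))"
        by (intro sum.cong) (auto simp: l_def)
      also have "\<dots> = (\<Sum>i\<in>UNIV. 1 - w $ i) - (\<Sum>i\<in>UNIV. min (1 - a) (1 - w $ i))"
        by (rule sum_subtractf)
      finally have "sum l UNIV
          = (\<Sum>i\<in>UNIV. 1 - w $ i) - (\<Sum>i\<in>UNIV. min (1 - a) (1 - w $ i))" .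
      moreover have "min (1 - a) (\<Sum>i\<in>UNIV. 1 - w $ i) \<le> (\<Sum>i\<in>UNIV. min (1 - a) (1 - w $ i))"
        using w01 a by (intro sum_min_const_ge) auto
      ultimately show ?thesis using a b by linarith
    qed
    \<comment> \<open>The least admissible total that is at least \<open>a - b\<close>.\<close>
    have "max (sum l UNIV) (a - b) \<le> sum h UNIV"
      using sum_h sum_mono[of UNIV l h] lh by simp
    then obtain x where x: "\<And>i. l i \<le> x i \<and> x i \<le> h i"
      and sum_x: "sum x UNIV = max (sum l UNIV) (a - b)"
      using sum_between[of UNIV l h "max (sum l UNIV) (a - b)"] lh
      by (metis UNIV_I finite max.cobounded1)
    have "\<exists>\<Phi>. \<Phi> 0 = 0 \<and> \<Phi> 1 = a \<and> \<Phi> (v $ i) = a \<and> \<Phi> (w $ i) = a - x i \<and>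
        mono \<Phi> \<and> mono (\<lambda>t. t - \<Phi> t)" for i
    proof -
      have "0 \<le> x i" "a - w $ i \<le> x i" "x i \<le> a" "x i \<le> max 0 (v $ i - w $ i)"
        using x[of i] by (auto simp: l_def h_def)
      then show ?thesis
        using margin_part[OF w01(1)[of i] w01(2)[of i] v01(2)[of i] av[of i], of "x i"] by metis
    qed
    then obtain \<Phi> where \<Phi>_0: "\<And>i. \<Phi> i 0 = 0" and \<Phi>_1: "\<And>i. \<Phi> i 1 = a"
      and \<Phi>_v: "\<And>i. \<Phi> i (v $ i) = a" and \<Phi>_w: "\<And>i. \<Phi> i (w $ i) = a - x i"
      and \<Phi>_mono: "\<And>i. mono (\<Phi> i)" and \<Phi>_lip: "\<And>i. mono (\<lambda>t. t - \<Phi> i t)"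
      by metis
    define F G where "F i t = \<Phi> i t / a" and "G i t = (t - \<Phi> i t) / (1 - a)" for i t
    have F: "unit_cdf (F i)" and G: "unit_cdf (G i)" for i
      using a01 monoD[OF \<Phi>_mono[of i]] monoD[OF \<Phi>_lip[of i]]
      by (auto simp: unit_cdf_def F_def G_def monotone_on_def \<Phi>_0 \<Phi>_1 intro!: divide_right_mono)
    obtain \<omega>1 :: "'n option \<Rightarrow> real" and g1 where m1: "mixture_margins \<omega>1 g1 F"
      and le1: "mixture_df \<omega>1 g1 w \<le> max 0 (1 - (\<Sum>i\<in>UNIV. 1 - F i (w $ i)))"
      using frechet_lower_bound_attained[of F, OF F w] by blast
    obtain \<omega>2 :: "'n option \<Rightarrow> real" and g2 where m2: "mixture_margins \<omega>2 g2 G"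
      and le2: "mixture_df \<omega>2 g2 w \<le> max 0 (1 - (\<Sum>i\<in>UNIV. 1 - G i (w $ i)))"
      using frechet_lower_bound_attained[of G, OF G w] by blast
    obtain \<omega> :: "bool \<times> 'n option \<Rightarrow> real" and g
      where m: "mixture_margins \<omega> g (\<lambda>i t. a * F i t + (1 - a) * G i t)"
        and C: "\<And>u. mixture_df \<omega> g u = a * mixture_df \<omega>1 g1 u + (1 - a) * mixture_df \<omega>2 g2 u"
      by (rule mixture_convex_combination[OF m1 m2 a]) (rule that)
    have "a * F i t + (1 - a) * G i t = t" for i t
      using a01 by (simp add: F_def G_def)
    then have cop: "copula (mixture_df \<omega> g)"
      using m by (intro copula_mixture_df) simp
    have "1 \<le> mixture_df \<omega>1 g1 v"
      using mixture_df_lower_bound(1)[OF m1 v] a01 by (simp add: F_def \<Phi>_v)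
    then have "a * 1 \<le> a * mixture_df \<omega>1 g1 v"
      using a by (intro mult_left_mono)
    moreover have "0 \<le> (1 - a) * mixture_df \<omega>2 g2 v"
      using mixture_df_lower_bound(2)[OF m2 v] a by simp
    ultimately have big: "a \<le> mixture_df \<omega> g v"
      unfolding C by linarith
    have "1 - F i (w $ i) = x i / a" for i
      using a01 by (simp add: F_def \<Phi>_w field_simps)
    then have "a * (1 - (\<Sum>i\<in>UNIV. 1 - F i (w $ i))) = a - sum x UNIV"
      using a01 by (simp add: right_diff_distrib flip: sum_divide_distrib)
    then have c1: "a * mixture_df \<omega>1 g1 w \<le> max 0 (a - sum x UNIV)"
      using mult_left_mono[OF le1 a(1)] by (simp add: max_mult_distrib_left a)
    have "1 - G i (w $ i) = ((1 - w $ i) - x i) / (1 - a)" for i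
      using a01 by (simp add: G_def \<Phi>_w field_simps)
    then have "(\<Sum>i\<in>UNIV. 1 - G i (w $ i)) = (\<Sum>i\<in>UNIV. (1 - w $ i) - x i) / (1 - a)"
      by (simp only: sum_divide_distrib)
    also have "(\<Sum>i\<in>UNIV. (1 - w $ i) - x i) = (\<Sum>i\<in>UNIV. 1 - w $ i) - sum x UNIV"
      by (rule sum_subtractf)
    finally have "(1 - a) * (1 - (\<Sum>i\<in>UNIV. 1 - G i (w $ i)))
        = 1 - a - (\<Sum>i\<in>UNIV. 1 - w $ i) + sum x UNIV"
      using a01 by (simp only: right_diff_distrib) simp
    then have c2: "(1 - a) * mixture_df \<omega>2 g2 w
        \<le> max 0 (1 - a - (\<Sum>i\<in>UNIV. 1 - w $ i) + sum x UNIV)"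
      using mult_left_mono[OF le2, of "1 - a"] a by (simp add: max_mult_distrib_left)
    have "mixture_df \<omega> g w \<le> b"
      using c1 c2 sum_x sum_l b unfolding C by linarith
    then show ?thesis using that[OF cop] big by (simp add: a_def b_def)
  qed
qed

theorem theorem2:
  fixes Q :: "real ^ 'n \<Rightarrow> real"
  assumes "CARD('n) \<ge> 2"
    and "quasi_copula Q"
  shows "(\<exists>\<F>. copula_family \<F> \<and>
            (\<forall>u\<in>unit_cube. Q u = (INF \<C>\<in>\<F>. SUP C\<in>\<C>. C u))) \<and>
         (\<exists>\<G>. copula_family \<G> \<and>
            (\<forall>u\<in>unit_cube. Q u = (SUP \<C>\<in>\<G>. INF C\<in>\<C>. C u)))"
proof -
  let ?I = "unit_cube :: (real ^ 'n) set"
  have "\<forall>v w. \<exists>C. v \<in> ?I \<longrightarrow> w \<in> ?I \<longrightarrow> copula C \<and> Q v \<le> C v \<and> C w \<le> Q w"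
    using copula_separating_two_points[OF assms(2)] by metis
  then obtain K where K: "\<And>v w. v \<in> ?I \<Longrightarrow> w \<in> ?I \<Longrightarrow> copula (K v w)"
      "\<And>v w. v \<in> ?I \<Longrightarrow> w \<in> ?I \<Longrightarrow> Q v \<le> K v w v"
      "\<And>v w. v \<in> ?I \<Longrightarrow> w \<in> ?I \<Longrightarrow> K v w w \<le> Q w"
    by metis
  have nonempty: "?I \<noteq> {}" by (auto simp: unit_cube_def intro!: exI[of _ 0])
  have bounds: "0 \<le> K v w u" "K v w u \<le> 1" if "v \<in> ?I" "w \<in> ?I" "u \<in> ?I" for v w u
    using K(1)[OF that(1,2)] that(3) by (auto simp: copula_def)
  define \<F> where "\<F> = (\<lambda>w. (\<lambda>v. K v w) ` ?I) ` ?I"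
  define \<G> where "\<G> = (\<lambda>v. K v ` ?I) ` ?I"
  have "copula_family \<F>" "copula_family \<G>"
    using K(1) nonempty by (auto simp: copula_family_def \<F>_def \<G>_def)
  moreover have "Q u = (INF \<C>\<in>\<F>. SUP C\<in>\<C>. C u)" if u: "u \<in> ?I" for u
  proof -
    have bdd: "bdd_above ((\<lambda>v. K v w u) ` ?I)" if "w \<in> ?I" for w
      using bounds that u by (auto intro!: bdd_aboveI[of _ 1])
    have ge: "Q u \<le> (SUP v\<in>?I. K v w u)" if w: "w \<in> ?I" for w
      using K(2)[OF u w] by (rule cSUP_upper2[OF bdd[OF w] u])
    have "(SUP v\<in>?I. K v u u) \<le> Q u"
      using K(3) u by (intro cSUP_least nonempty) auto
    then have "(INF w\<in>?I. SUP v\<in>?I. K v w u) \<le> Q u"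
      using ge u by (intro cINF_lower2[of _ _ u]) (auto intro!: bdd_belowI[of _ "Q u"])
    moreover have "Q u \<le> (INF w\<in>?I. SUP v\<in>?I. K v w u)"
      using ge by (intro cINF_greatest nonempty) auto
    ultimately show ?thesis by (simp add: \<F>_def image_image)
  qed
  moreover have "Q u = (SUP \<C>\<in>\<G>. INF C\<in>\<C>. C u)" if u: "u \<in> ?I" for u
  proof -
    have bdd: "bdd_below ((\<lambda>w. K v w u) ` ?I)" if "v \<in> ?I" for v
      using bounds that u by (auto intro!: bdd_belowI[of _ 0])
    have le: "(INF w\<in>?I. K v w u) \<le> Q u" if v: "v \<in> ?I" for v
      using K(3)[OF v u] by (rule cINF_lower2[OF bdd[OF v] u])
    have "Q u \<le> (INF w\<in>?I. K u w u)"
      using K(2) u by (intro cINF_greatest nonempty) auto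
    then have "Q u \<le> (SUP v\<in>?I. INF w\<in>?I. K v w u)"
      using le u by (intro cSUP_upper2[of _ _ u]) (auto intro!: bdd_aboveI[of _ "Q u"])
    moreover have "(SUP v\<in>?I. INF w\<in>?I. K v w u) \<le> Q u"
      using le by (intro cSUP_least nonempty) auto
    ultimately show ?thesis by (simp add: \<G>_def image_image)
  qed
  ultimately show ?thesis by blast
qed

end
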